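(* Let $G$ be a topological gyrogroup with an $\omega^{\omega}$-base $\{U_{\alpha}:\alpha\in\mathbb{N}^{\mathbb{N}}\}$. For $\alpha\in\mathbb{N}^{\mathbb{N}}$ and $k\in\mathbb{N}$ put $D_k(\alpha)=\bigcap_{\beta\in I_k(\alpha)}U_\beta$, where $I_k(\alpha)=\{\beta\in\mathbb{N}^{\mathbb{N}}:\beta_i=\alpha_i\text{ for }i=1,\dots,k\}$. Suppose that for every $\alpha\in\mathbb{N}^{\mathbb{N}}$ the set $\bigcup_{k\in\mathbb{N}}D_k(\alpha)$ is a neighborhood of the identity element $0$. Then $G$ has the strong Pytkeev property.
   Context: $\mathbb{N}$ is the set of positive integers. All topological spaces are assumed Hausdorff. A gyrogroup is a set $G$ with a binary operation $\oplus$ such that: (G1) there is a unique $0\in G$ with $0\oplus a=a=a\oplus 0$ for all $a$; (G2) for each $x$ there is a unique $\ominus x\in G$ with $\ominus x\oplus x=0=x\oplus(\ominus x)$; (G3) for all $x,y\in G$ there is an automorphism $\mathrm{gyr}[x,y]$ of $(G,\oplus)$ with $x\oplus(y\oplus z)=(x\oplus y)\oplus\mathrm{gyr}[x,y](z)$ for all $z\in G$; (G4) $\mathrm{gyr}[x\oplus y,y]=\mathrm{gyr}[x,y]$ for all $x,y\in G$. A topological gyrogroup is a gyrogroup with a topology for which $\oplus:G\times G\to G$ is jointly continuous and $x\mapsto\ominus x$ is continuous. $\mathbb{N}^{\mathbb{N}}$ carries the pointwise partial order: $\alpha\le\beta$ iff $\alpha_i\le\beta_i$ for all $i$. An $\omega^{\omega}$-base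 of a topological gyrogroup $G$ is a family $\{U_\alpha:\alpha\in\mathbb{N}^{\mathbb{N}}\}$ of neighborhoods of $0$ that is a base of neighborhoods at $0$ and satisfies $U_\beta\subset U_\alpha$ whenever $\alpha\le\beta$. $G$ has the strong Pytkeev property if there is a sequence $\{D_n\}_{n\in\mathbb{N}}$ of subsets of $G$ such that for each neighborhood $U$ of $0$ and each $A\subset G$ with $0\in\overline{A}\setminus A$ there is $n\in\mathbb{N}$ such that $D_n\subset U$ and $D_n\cap A$ is infinite. *)

theory Defs
  imports "HOL-Analysis.Elementary_Topology" "HOL-Library.FuncSet"
begin

locale gyrogroup =
  fixes oplus :: "'a \<Rightarrow> 'a \<Rightarrow> 'a" (infixl "\<oplus>" 65)
    and zero :: 'a ("\<zero>")
    and ominus :: "'a \<Rightarrow> 'a" ("\<ominus> _" [81] 80)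
    and gyr :: "'a \<Rightarrow> 'a \<Rightarrow> 'a \<Rightarrow> 'a"
  assumes zero_left: "\<zero> \<oplus> a = a"
    and zero_right: "a \<oplus> \<zero> = a"
    and zero_unique: "(\<And>a. e \<oplus> a = a \<and> a \<oplus> e = a) \<Longrightarrow> e = \<zero>"
    and ominus_left: "(\<ominus> x) \<oplus> x = \<zero>"
    and ominus_right: "x \<oplus> (\<ominus> x) = \<zero>"
    and ominus_unique: "y \<oplus> x = \<zero> \<Longrightarrow> x \<oplus> y = \<zero> \<Longrightarrow> y = \<ominus> x"
    and gyr_bij: "bij (gyr x y)"
    and gyr_hom: "gyr x y (a \<oplus> b) = gyr x y a \<oplus> gyr x y b"
    and gyr_assoc: "x \<oplus> (y \<oplus> z) = (x \<oplus> y) \<oplus> gyr x y z"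
    and gyr_loop: "gyr (x \<oplus> y) y = gyr x y"

locale topological_gyrogroup = gyrogroup oplus zero ominus gyr
  for oplus :: "'a::t2_space \<Rightarrow> 'a \<Rightarrow> 'a"
    and zero :: 'a
    and ominus :: "'a \<Rightarrow> 'a"
    and gyr :: "'a \<Rightarrow> 'a \<Rightarrow> 'a \<Rightarrow> 'a" +
  assumes continuous_oplus: "continuous_on UNIV (\<lambda>(x, y). oplus x y)"
    and continuous_ominus: "continuous_on UNIV ominus"

text \<open>Neighborhoods are not required to be open.\<close>

definition neighborhood :: "'a::topological_space \<Rightarrow> 'a set \<Rightarrow> bool" where
  "neighborhood x U \<longleftrightarrow> x \<in> interior U"

text \<open>
  The set of sequences of positive integers indexed by the positive integers. Its elements are
  extensional: they all take the value \<^const>\<open>undefined\<close> at the index 0, so the pointwise order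
  of the type \<^typ>\<open>nat \<Rightarrow> nat\<close>, restricted to this set, compares exactly the entries with
  index at least 1.
\<close>

definition pos_seqs :: "(nat \<Rightarrow> nat) set" where
  "pos_seqs = {1..} \<rightarrow>\<^sub>E {1..}"

text \<open>In the next two definitions \<open>e\<close> is to be the identity of the gyrogroup.\<close>

definition omega_omega_base :: "'a::topological_space \<Rightarrow> ((nat \<Rightarrow> nat) \<Rightarrow> 'a set) \<Rightarrow> bool" where
  "omega_omega_base e U \<longleftrightarrow>
     (\<forall>\<alpha>\<in>pos_seqs. neighborhood e (U \<alpha>)) \<and>
     (\<forall>V. neighborhood e V \<longrightarrow> (\<exists>\<alpha>\<in>pos_seqs. U \<alpha> \<subseteq> V)) \<and>
     (\<forall>\<alpha>\<in>pos_seqs. \<forall>\<beta>\<in>pos_seqs. \<alpha> \<le> \<beta> \<longrightarrow> U \<beta> \<subseteq> U \<alpha>)"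

definition strong_Pytkeev :: "'a::topological_space \<Rightarrow> bool" where
  "strong_Pytkeev e \<longleftrightarrow>
     (\<exists>D :: nat \<Rightarrow> 'a set. \<forall>U A. neighborhood e U \<longrightarrow> e \<in> closure A - A \<longrightarrow>
        (\<exists>n\<ge>1. D n \<subseteq> U \<and> infinite (D n \<inter> A)))"

definition same_prefix :: "nat \<Rightarrow> (nat \<Rightarrow> nat) \<Rightarrow> (nat \<Rightarrow> nat) set" where
  "same_prefix k \<alpha> = {\<beta> \<in> pos_seqs. \<forall>i\<in>{1..k}. \<beta> i = \<alpha> i}"

definition prefix_Inter :: "((nat \<Rightarrow> nat) \<Rightarrow> 'a set) \<Rightarrow> nat \<Rightarrow> (nat \<Rightarrow> nat) \<Rightarrow> 'a set" where
  "prefix_Inter U k \<alpha> = (\<Inter>\<beta>\<in>same_prefix k \<alpha>. U \<beta>)"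

end

theory Submission
  imports Defs "HOL-Library.Countable"
begin

text \<open>
  The set \<open>D\<^sub>k(\<alpha>)\<close> depends only on the first \<open>k\<close> entries of \<open>\<alpha>\<close>, so there are only countably many
  such sets, and they can serve as the sequence in the strong Pytkeev property. Given a neighborhood
  \<open>V\<close> of the identity \<open>e\<close>, take \<open>\<alpha>\<close> with \<open>U\<^sub>\<alpha> \<subseteq> V\<close>; then \<open>D\<^sub>k(\<alpha>) \<subseteq> U\<^sub>\<alpha> \<subseteq> V\<close> for every \<open>k\<close>. What
  remains is that some \<open>D\<^sub>k(\<alpha>)\<close> meets \<open>A\<close> in an infinite set.

  Suppose that all the sets \<open>A \<inter> D\<^sub>k(\<alpha>)\<close> are finite. A point \<open>x\<close> of \<open>A\<close> in \<open>D\<^bsub>k+1\<^esub>(\<alpha>) - D\<^sub>k(\<alpha>)\<close> is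
  excluded from some \<open>U\<^bsub>\<beta>(x)\<^esub>\<close> where \<open>\<beta>(x)\<close> agrees with \<open>\<alpha>\<close> up to the index \<open>k\<close>. At a fixed index
  \<open>i\<close> only the points of the finite set \<open>A \<inter> D\<^sub>i(\<alpha>)\<close> can have an entry \<open>\<beta>(x)\<^sub>i \<noteq> \<alpha>\<^sub>i\<close>, so all the
  \<open>\<beta>(x)\<close> have a common upper bound \<open>\<gamma>\<close>. By monotonicity \<open>U\<^sub>\<gamma>\<close> contains none of the points \<open>x\<close>. Hence
  the neighborhood \<open>U\<^sub>\<gamma> \<inter> (\<Union>k. D\<^sub>k(\<alpha>))\<close> of \<open>e\<close> meets \<open>A\<close> in a finite set, which is impossible
  when \<open>e\<close> is in the closure of \<open>A\<close> but not in \<open>A\<close> and points are closed.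

  The topological part of the argument concerns a single point \<open>e\<close> of a \<open>T\<^sub>1\<close> space, and it is stated
  in that form.
\<close>

lemma same_prefix_self: "\<alpha> \<in> pos_seqs \<Longrightarrow> \<alpha> \<in> same_prefix k \<alpha>"
  by (simp add: same_prefix_def)

lemma prefix_Inter_subset: "\<alpha> \<in> pos_seqs \<Longrightarrow> prefix_Inter U k \<alpha> \<subseteq> U \<alpha>"
  unfolding prefix_Inter_def using same_prefix_self by blast

lemma prefix_Inter_mono: "k \<le> l \<Longrightarrow> prefix_Inter U k \<alpha> \<subseteq> prefix_Inter U l \<alpha>"
  unfolding prefix_Inter_def same_prefix_def by fastforce

lemma prefix_Inter_cong:
  assumes "\<And>i. i \<in> {1..k} \<Longrightarrow> \<alpha> i = \<beta> i"
  shows "prefix_Inter U k \<alpha> = prefix_Inter U k \<beta>"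
  using assms unfolding prefix_Inter_def same_prefix_def by auto

text \<open>A finite prefix is a list of natural numbers, and there are countably many of these.\<close>

lemma prefix_Inters_enumerable:
  fixes U :: "(nat \<Rightarrow> nat) \<Rightarrow> 'a set"
  obtains D :: "nat \<Rightarrow> 'a set" where "\<forall>k \<alpha>. \<exists>n\<ge>1. D n = prefix_Inter U k \<alpha>"
proof
  \<comment> \<open>The list holds the entries with indices \<open>0, \<dots>, k\<close>, so that list positions are indices. The shift
      of \<open>n\<close> by one makes the enumeration start at 1.\<close>
  define D where
    "D n = (let xs = from_nat (n - 1) :: nat list in prefix_Inter U (length xs - 1) ((!) xs))" for n
  show "\<forall>k \<alpha>. \<exists>n\<ge>1. D n = prefix_Inter U k \<alpha>"
  proof (intro allI exI conjI)
    fix k :: nat and \<alpha> :: "nat \<Rightarrow> nat"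
    let ?xs = "map \<alpha> [0..<Suc k]"
    show "D (Suc (to_nat ?xs)) = prefix_Inter U k \<alpha>"
      unfolding D_def Let_def
      by (simp del: upt_Suc, rule prefix_Inter_cong, simp del: upt_Suc)
  qed simp
qed

text \<open>
  The family \<open>\<beta>\<close> may be infinite. An upper bound exists nevertheless, because at each index all but
  finitely many members take the same value as \<open>\<alpha>\<close>.
\<close>

lemma pos_seqs_upper_bound:
  assumes \<alpha>: "\<alpha> \<in> pos_seqs"
    and \<beta>: "\<And>x. x \<in> B \<Longrightarrow> \<beta> x \<in> pos_seqs"
    and fin: "\<And>i. i \<ge> 1 \<Longrightarrow> finite {x \<in> B. \<beta> x i \<noteq> \<alpha> i}"
  obtains \<gamma> where "\<gamma> \<in> pos_seqs" and "\<forall>x\<in>B. \<beta> x \<le> \<gamma>"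
proof
  define M where "M i = insert (\<alpha> i) ((\<lambda>x. \<beta> x i) ` {x \<in> B. \<beta> x i \<noteq> \<alpha> i})" for i
  define \<gamma> where "\<gamma> = restrict (\<lambda>i. Max (M i)) {1..}"
  have finM: "finite (M i)" if "i \<ge> 1" for i
    unfolding M_def using fin[OF that] by simp
  have "1 \<le> \<alpha> i" if "i \<ge> 1" for i
    using \<alpha> that unfolding pos_seqs_def by auto
  moreover have "\<alpha> i \<le> Max (M i)" if "i \<ge> 1" for i
    using finM[OF that] by (simp add: M_def)
  ultimately have "1 \<le> Max (M i)" if "i \<ge> 1" for i
    using that le_trans by blast
  then show "\<gamma> \<in> pos_seqs"
    unfolding \<gamma>_def pos_seqs_def by auto
  show "\<forall>x\<in>B. \<beta> x \<le> \<gamma>"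
  proof (intro ballI le_funI)
    fix x i
    assume x: "x \<in> B"
    show "\<beta> x i \<le> \<gamma> i"
    proof (cases "i \<ge> 1")
      case True
      have "\<beta> x i \<in> M i"
        unfolding M_def using x by auto
      then show ?thesis
        using True finM[OF True] by (simp add: \<gamma>_def)
    next
      case False
      \<comment> \<open>At index 0 both sequences take the value \<^const>\<open>undefined\<close>.\<close>
      then have "\<beta> x i = undefined" and "\<gamma> i = undefined"
        using PiE_arb[OF \<beta>[OF x, unfolded pos_seqs_def], of i] by (simp_all add: \<gamma>_def)
      then show ?thesis by simp
    qed
  qed
qed

text \<open>
  This is the diagonal step. A point outside \<^term>\<open>prefix_Inter U k \<alpha>\<close> can be avoided without changing
  the first \<open>k\<close> entries of \<open>\<alpha>\<close>. When only finitely many points have to be avoided at each level \<open>k\<close>,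
  the sequences that avoid them have an upper bound \<open>\<gamma>\<close>, and \<open>U\<^sub>\<gamma>\<close> avoids all the points at once.
\<close>

lemma avoid_finite_levels:
  assumes antimono: "\<And>\<beta> \<gamma>. \<beta> \<in> pos_seqs \<Longrightarrow> \<gamma> \<in> pos_seqs \<Longrightarrow> \<beta> \<le> \<gamma> \<Longrightarrow> U \<gamma> \<subseteq> U \<beta>"
    and \<alpha>: "\<alpha> \<in> pos_seqs"
    and fin: "\<And>k. k \<ge> 1 \<Longrightarrow> finite (prefix_Inter U k \<alpha> \<inter> A)"
  obtains \<gamma> where "\<gamma> \<in> pos_seqs"
    and "finite (U \<gamma> \<inter> (\<Union>k\<in>{1..}. prefix_Inter U k \<alpha>) \<inter> A)"
proof -
  define B where "B = (\<Union>k\<in>{1..}. prefix_Inter U k \<alpha>) \<inter> A - prefix_Inter U 1 \<alpha>"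
  have "\<exists>\<beta> k. x \<in> prefix_Inter U (Suc k) \<alpha> \<and> \<beta> \<in> same_prefix k \<alpha> \<and> x \<notin> U \<beta>"
    if x: "x \<in> B" for x
  proof -
    obtain m where "x \<in> prefix_Inter U m \<alpha>"
      using x unfolding B_def by blast
    moreover have "x \<notin> prefix_Inter U 0 \<alpha>"
      using x prefix_Inter_mono[of 0 1 U \<alpha>] unfolding B_def by auto
    ultimately obtain k where "x \<notin> prefix_Inter U k \<alpha>" "x \<in> prefix_Inter U (Suc k) \<alpha>"
      using ex_least_nat_less[of "\<lambda>k. x \<in> prefix_Inter U k \<alpha>" m] by blast
    then show ?thesis
      unfolding prefix_Inter_def by blast
  qed
  then obtain \<beta> k where level: "\<And>x. x \<in> B \<Longrightarrow> x \<in> prefix_Inter U (Suc (k x)) \<alpha>"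
    and prefix: "\<And>x. x \<in> B \<Longrightarrow> \<beta> x \<in> same_prefix (k x) \<alpha>"
    and avoid: "\<And>x. x \<in> B \<Longrightarrow> x \<notin> U (\<beta> x)"
    by metis
  have pos: "\<beta> x \<in> pos_seqs" if "x \<in> B" for x
    using prefix[OF that] by (simp add: same_prefix_def)
  have finite_changes: "finite {x \<in> B. \<beta> x i \<noteq> \<alpha> i}" if i: "i \<ge> 1" for i
  proof (rule finite_subset)
    show "{x \<in> B. \<beta> x i \<noteq> \<alpha> i} \<subseteq> prefix_Inter U i \<alpha> \<inter> A"
    proof
      fix x assume "x \<in> {x \<in> B. \<beta> x i \<noteq> \<alpha> i}"
      then have x: "x \<in> B" and "\<beta> x i \<noteq> \<alpha> i" by auto
      then have "Suc (k x) \<le> i"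
        using prefix[OF x] i unfolding same_prefix_def by force
      then show "x \<in> prefix_Inter U i \<alpha> \<inter> A"
        using subsetD[OF prefix_Inter_mono level[OF x]] x by (simp add: B_def)
    qed
  qed (rule fin[OF i])
  obtain \<gamma> where \<gamma>: "\<gamma> \<in> pos_seqs" and bound: "\<forall>x\<in>B. \<beta> x \<le> \<gamma>"
    using pos_seqs_upper_bound[of \<alpha> B \<beta>, OF \<alpha> pos finite_changes] .
  have "x \<notin> U \<gamma>" if "x \<in> B" for x
    using antimono[OF pos[OF that] \<gamma> bspec[OF bound that]] avoid[OF that] by blast
  then have "U \<gamma> \<inter> (\<Union>k\<in>{1..}. prefix_Inter U k \<alpha>) \<inter> A \<subseteq> prefix_Inter U 1 \<alpha> \<inter> A"
    unfolding B_def by blast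
  then have "finite (U \<gamma> \<inter> (\<Union>k\<in>{1..}. prefix_Inter U k \<alpha>) \<inter> A)"
    using fin[of 1] by (rule finite_subset) simp
  with \<gamma> show ?thesis by (rule that)
qed

lemma neighborhood_Int: "neighborhood x V \<Longrightarrow> neighborhood x W \<Longrightarrow> neighborhood x (V \<inter> W)"
  by (simp add: neighborhood_def)

lemma infinite_neighborhood_Int_of_limit_point:
  fixes x :: "'a::t1_space"
  assumes V: "neighborhood x V" and x: "x \<in> closure A - A"
  shows "infinite (V \<inter> A)"
proof
  assume "finite (V \<inter> A)"
  then have "open (interior V - V \<inter> A)"
    by (intro open_Diff finite_imp_closed open_interior)
  moreover have "x \<in> interior V - V \<inter> A"
    using V x by (simp add: neighborhood_def)
  ultimately have "(interior V - V \<inter> A) \<inter> A \<noteq> {}"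
    using x open_Int_closure_eq_empty by blast
  then show False
    using interior_subset by blast
qed

lemma omega_omega_base_strong_Pytkeev:
  fixes e :: "'a::t1_space"
  assumes base: "omega_omega_base e U"
    and union: "\<And>\<alpha>. \<alpha> \<in> pos_seqs \<Longrightarrow> neighborhood e (\<Union>k\<in>{1..}. prefix_Inter U k \<alpha>)"
  shows "strong_Pytkeev e"
proof -
  obtain D :: "nat \<Rightarrow> 'a set" where D: "\<forall>k \<alpha>. \<exists>n\<ge>1. D n = prefix_Inter U k \<alpha>"
    using prefix_Inters_enumerable[of U] .
  have nbhd: "\<forall>\<alpha>\<in>pos_seqs. neighborhood e (U \<alpha>)"
    and small: "\<forall>V. neighborhood e V \<longrightarrow> (\<exists>\<alpha>\<in>pos_seqs. U \<alpha> \<subseteq> V)"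
    and anti: "\<forall>\<beta>\<in>pos_seqs. \<forall>\<gamma>\<in>pos_seqs. \<beta> \<le> \<gamma> \<longrightarrow> U \<gamma> \<subseteq> U \<beta>"
    using base[unfolded omega_omega_base_def]
    by (rule conjunct1, rule conjunct1[OF conjunct2], rule conjunct2[OF conjunct2])
  have "\<exists>n\<ge>1. D n \<subseteq> V \<and> infinite (D n \<inter> A)"
    if V: "neighborhood e V" and A: "e \<in> closure A - A" for V A
  proof -
    obtain \<alpha> where \<alpha>: "\<alpha> \<in> pos_seqs" and "U \<alpha> \<subseteq> V"
      using small V by blast
    then have sub: "prefix_Inter U k \<alpha> \<subseteq> V" for k
      using prefix_Inter_subset[OF \<alpha>, of U k] by (simp only: order_trans)
    have "\<exists>k\<ge>1. infinite (prefix_Inter U k \<alpha> \<inter> A)"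
    proof (rule ccontr)
      assume "\<not> ?thesis"
      then have levels: "finite (prefix_Inter U k \<alpha> \<inter> A)" if "k \<ge> 1" for k
        using that by blast
      obtain \<gamma> where \<gamma>: "\<gamma> \<in> pos_seqs"
        and fin: "finite (U \<gamma> \<inter> (\<Union>k\<in>{1..}. prefix_Inter U k \<alpha>) \<inter> A)"
        using avoid_finite_levels[of U \<alpha> A, OF anti[rule_format] \<alpha> levels] .
      have "neighborhood e (U \<gamma> \<inter> (\<Union>k\<in>{1..}. prefix_Inter U k \<alpha>))"
        using bspec[OF nbhd \<gamma>] union[OF \<alpha>] by (rule neighborhood_Int)
      from infinite_neighborhood_Int_of_limit_point[OF this A] fin show False
        by contradiction
    qed
    then obtain k where k: "infinite (prefix_Inter U k \<alpha> \<inter> A)" by blast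
    obtain n where n: "n \<ge> 1" "D n = prefix_Inter U k \<alpha>"
      using D by blast
    have "D n \<subseteq> V" and "infinite (D n \<inter> A)"
      unfolding n(2) using sub[of k] k by this+
    with n(1) show ?thesis by (intro exI conjI)
  qed
  then show ?thesis
    unfolding strong_Pytkeev_def by (intro exI[of _ D] allI impI)
qed

theorem theorem3p2:
  fixes oplus :: "'a::t2_space \<Rightarrow> 'a \<Rightarrow> 'a"
    and zero :: 'a
    and ominus :: "'a \<Rightarrow> 'a"
    and gyr :: "'a \<Rightarrow> 'a \<Rightarrow> 'a \<Rightarrow> 'a"
    and U :: "(nat \<Rightarrow> nat) \<Rightarrow> 'a set"
  assumes "topological_gyrogroup oplus zero ominus gyr"
    and "omega_omega_base zero U"
    and "\<And>\<alpha>. \<alpha> \<in> pos_seqs \<Longrightarrow> neighborhood zero (\<Union>k\<in>{1..}. prefix_Inter U k \<alpha>)"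
  shows "strong_Pytkeev zero"
  using assms(2,3) by (rule omega_omega_base_strong_Pytkeev)

end
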